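(* Let $X$ be a real or complex Banach space with scalar field $\mathbb{K}\in\{\mathbb{R},\mathbb{C}\}$, and let $T$ be a closable operator in $X$ whose domain $D(T)$ is separable (in the norm topology) and weakly $\sigma$-compact. Then for every finite $n\geq 1$ the set $\sigma_{p[n]}(T)$ is the intersection of an $F_\sigma$ subset and a $G_\delta$ subset of $\mathbb{K}$, and the set $\sigma_{p[\infty]}(T)$ is an $F_{\sigma\delta}$ subset of $\mathbb{K}$.
   Context: Banach spaces are real or complex and need not be separable. An operator in $X$ is a linear map $T\colon D(T)\to X$ defined on a linear subspace $D(T)$ of $X$ (not necessarily bounded, closed or densely defined). $T$ is closable if the norm closure in $X\times X$ of its graph $\{(x,Tx): x\in D(T)\}$ is the graph of some operator in $X$. A subset of a Banach space is weakly $\sigma$-compact if it is a countable union of sets that are compact in the weak topology. For $\lambda\in\mathbb{K}$, $T-\lambda$ has domain $D(T)$. The point spectrum is $\sigma_p(T)=\{\lambda\in\mathbb{K}:\ker(T-\lambda)\neq\{0\}\}$. For finite $n\geq 1$, $\sigma_{p[n]}(T)=\{\lambda\in\mathbb{K}:\dim\ker(T-\lambda)=n\}$, and $\sigma_{p[\infty]}(T)=\sigma_p(T)\setminus\bigcup_{n=1}^\infty\sigma_{p[n]}(T)$, i.e. the set of $\lambda$ for which $\ker(T-\lambda)$ is infinite-dimensional. *)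

theory Defs
  imports "HOL-Analysis.Analysis"
begin

text \<open>
  The library has no class of complex Banach spaces. A complex Banach space is modelled as a
  real Banach space with a complex scalar multiplication that extends the real one and for which
  the given norm is homogeneous. The other notions below take the scalar multiplication as a
  parameter, so that they apply to real Banach spaces (with \<open>(*\<^sub>R)\<close>) and to
  complex ones alike.
\<close>

locale complex_banach_space = vector_space scl
  for scl :: "complex \<Rightarrow> 'a::banach \<Rightarrow> 'a" +
  assumes scale_complex_of_real: "scl (complex_of_real r) x = r *\<^sub>R x"
    and norm_scale: "norm (scl c x) = cmod c * norm x"

text \<open>
  An operator is represented by its domain \<open>D\<close> and a total function \<open>T\<close>
  whose values outside \<open>D\<close> are irrelevant.
\<close>

definition operator_in ::
    "('k::real_normed_field \<Rightarrow> 'a::real_normed_vector \<Rightarrow> 'a) \<Rightarrow> 'a set \<Rightarrow> ('a \<Rightarrow> 'a) \<Rightarrow> bool" where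
  "operator_in scl D T \<longleftrightarrow>
     module.subspace scl D \<and>
     (\<forall>x\<in>D. \<forall>y\<in>D. T (x + y) = T x + T y) \<and>
     (\<forall>c. \<forall>x\<in>D. T (scl c x) = scl c (T x))"

definition operator_graph :: "'a set \<Rightarrow> ('a \<Rightarrow> 'a) \<Rightarrow> ('a \<times> 'a) set" where
  "operator_graph D T = {(x, T x) | x. x \<in> D}"

definition closable_operator ::
    "('k::real_normed_field \<Rightarrow> 'a::real_normed_vector \<Rightarrow> 'a) \<Rightarrow> 'a set \<Rightarrow> ('a \<Rightarrow> 'a) \<Rightarrow> bool" where
  "closable_operator scl D T \<longleftrightarrow>
     operator_in scl D T \<and>
     (\<exists>E S. operator_in scl E S \<and> closure (operator_graph D T) = operator_graph E S)"

definition weak_topology ::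
    "('k::real_normed_field \<Rightarrow> 'a::real_normed_vector \<Rightarrow> 'a) \<Rightarrow> 'a topology" where
  "weak_topology scl =
     topology_generated_by
       {f -` U | f U. Vector_Spaces.linear scl (*) f \<and> continuous_on UNIV f \<and> open U}"

definition weakly_sigma_compact ::
    "('k::real_normed_field \<Rightarrow> 'a::real_normed_vector \<Rightarrow> 'a) \<Rightarrow> 'a set \<Rightarrow> bool" where
  "weakly_sigma_compact scl S \<longleftrightarrow>
     (\<exists>\<C>. countable \<C> \<and> (\<forall>C\<in>\<C>. compactin (weak_topology scl) C) \<and> \<Union>\<C> = S)"

definition operator_kernel ::
    "('k::real_normed_field \<Rightarrow> 'a::real_normed_vector \<Rightarrow> 'a) \<Rightarrow> 'a set \<Rightarrow> ('a \<Rightarrow> 'a) \<Rightarrow> 'k \<Rightarrow> 'a set" where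
  "operator_kernel scl D T l = {x \<in> D. T x - scl l x = 0}"

definition point_spectrum ::
    "('k::real_normed_field \<Rightarrow> 'a::real_normed_vector \<Rightarrow> 'a) \<Rightarrow> 'a set \<Rightarrow> ('a \<Rightarrow> 'a) \<Rightarrow> 'k set" where
  "point_spectrum scl D T = {l. operator_kernel scl D T l \<noteq> {0}}"

text \<open>
  \<^const>\<open>vector_space.dim\<close> is \<open>0\<close> on infinite-dimensional subspaces, so the following
  is only meaningful for \<open>n \<ge> 1\<close>.
\<close>

definition point_spectrum_dim ::
    "('k::real_normed_field \<Rightarrow> 'a::real_normed_vector \<Rightarrow> 'a) \<Rightarrow> 'a set \<Rightarrow> ('a \<Rightarrow> 'a) \<Rightarrow> nat \<Rightarrow> 'k set" where
  "point_spectrum_dim scl D T n = {l. vector_space.dim scl (operator_kernel scl D T l) = n}"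

definition point_spectrum_inf ::
    "('k::real_normed_field \<Rightarrow> 'a::real_normed_vector \<Rightarrow> 'a) \<Rightarrow> 'a set \<Rightarrow> ('a \<Rightarrow> 'a) \<Rightarrow> 'k set" where
  "point_spectrum_inf scl D T =
     point_spectrum scl D T - (\<Union>n\<in>{1..}. point_spectrum_dim scl D T n)"

definition fsigma_delta :: "'a::topological_space set \<Rightarrow> bool" where
  "fsigma_delta S \<longleftrightarrow> (\<exists>F :: nat \<Rightarrow> 'a set. (\<forall>i. fsigma (F i)) \<and> S = (\<Inter>i. F i))"

end

theory Submission
  imports Defs
begin

text \<open>
  Let \<open>A n\<close> be the set of \<open>\<lambda>\<close> for which \<open>ker (T - \<lambda>)\<close> contains \<open>n\<close> linearly independent
  vectors. Then \<open>\<sigma>\<^sub>p\<^sub>[\<^sub>n\<^sub>] = A n - A (n + 1)\<close> and \<open>\<sigma>\<^sub>p\<^sub>[\<^sub>\<infinity>\<^sub>]\<close> is the intersection of all \<open>A n\<close>, so it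
  suffices that every \<open>A n\<close> is an \<open>F\<^sub>\<sigma>\<close> set. As \<open>D\<close> is separable, countably many continuous
  functionals separate its points, and \<open>\<lambda> \<in> A n\<close> iff some \<open>n\<close> of them have a biorthogonal system
  of vectors in \<open>ker (T - \<lambda>)\<close>. For fixed functionals this is a conjunction of \<open>n\<close> conditions, each
  on a single vector \<open>x\<close>, and if \<open>x\<close> is restricted to a weakly compact subset of \<open>D\<close>, each of them
  defines a closed set of \<open>\<lambda>\<close>: the closed graph is weakly closed by Hahn-Banach, so this set is the
  projection of a closed set along a compact factor.
\<close>

section \<open>Hahn-Banach theorem\<close>

definition sublinear :: "('a::real_vector \<Rightarrow> real) \<Rightarrow> bool" where
  "sublinear p \<longleftrightarrow>
     (\<forall>x y. p (x + y) \<le> p x + p y) \<and> (\<forall>c x. 0 \<le> c \<longrightarrow> p (c *\<^sub>R x) = c * p x)"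

lemma sublinearD:
  assumes "sublinear p"
  shows "p (x + y) \<le> p x + p y" "0 \<le> c \<Longrightarrow> p (c *\<^sub>R x) = c * p x" "p 0 = 0" "- p (- x) \<le> p x"
proof -
  show 1: "p (x + y) \<le> p x + p y" for x y
    using assms by (simp add: sublinear_def)
  show 2: "0 \<le> c \<Longrightarrow> p (c *\<^sub>R x) = c * p x" for c x
    using assms by (simp add: sublinear_def)
  show 3: "p 0 = 0"
    using 2[of 0 0] by simp
  show "- p (- x) \<le> p x"
    using 1[of x "- x"] 3 by simp
qed

text \<open>Used at \<open>inverse c\<close> and \<open>c *\<^sub>R x\<close>, the inequality
  \<open>le\<close> yields its own converse, so a function defined as an infimum needs only a
  one-sided estimate.\<close>

lemma sublinearI:
  fixes p :: "'a::real_vector \<Rightarrow> real"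
  assumes add: "\<And>x y. p (x + y) \<le> p x + p y" and zero: "p 0 = 0"
    and le: "\<And>c x. 0 < c \<Longrightarrow> p (c *\<^sub>R x) \<le> c * p x"
  shows "sublinear p"
  unfolding sublinear_def
proof (intro conjI allI impI)
  fix c :: real and x
  assume "0 \<le> c"
  show "p (c *\<^sub>R x) = c * p x"
  proof (cases "c = 0")
    case False
    with \<open>0 \<le> c\<close> have c: "0 < c" by simp
    have "p x \<le> inverse c * p (c *\<^sub>R x)"
      using le[of "inverse c" "c *\<^sub>R x"] c by simp
    then have "c * p x \<le> p (c *\<^sub>R x)"
      using c by (simp add: field_simps)
    with le[OF c, of x] show ?thesis by simp
  qed (simp add: zero)
qed (rule add)

text \<open>
  Tilting turns a minimal sublinear function into an odd one, hence into a linear functional.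
  This gives the Hahn-Banach theorem without extending functionals from subspaces.
\<close>

lemma sublinear_tilt:
  fixes p :: "'a::real_vector \<Rightarrow> real"
  assumes p: "sublinear p"
  obtains q where "sublinear q" "\<And>x. q x \<le> p x" "q (- y) \<le> - p y"
proof
  \<comment> \<open>A sublinear function below \<open>p\<close> with value at most
    \<open>- p y\<close> at \<open>- y\<close> is bounded at \<open>x\<close> by
    \<open>v x t\<close> for all \<open>t \<ge> 0\<close>, because \<open>x\<close> is the sum of
    \<open>x + t *\<^sub>R y\<close> and \<open>t\<close> times \<open>- y\<close>. The infimum
    \<open>q\<close> of these bounds is the largest such function.\<close>
  define v where "v x t = p (x + t *\<^sub>R y) - t * p y" for x t
  define q where "q x = (INF t\<in>{0..}. v x t)" for x
  \<comment> \<open>The bound does not depend on \<open>t\<close>, so the infimum is finite.\<close>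
  have lower: "- p (- x) \<le> v x t" if "0 \<le> t" for x t
    using sublinearD(1)[OF p, of "x + t *\<^sub>R y" "- x"] sublinearD(2)[OF p that, of y]
    by (simp add: v_def)
  have q_le: "q x \<le> v x t" if "0 \<le> t" for x t
    unfolding q_def using that lower by (intro cINF_lower bdd_belowI2[of _ "- p (- x)"]) auto
  have q_greatest: "a \<le> q x" if "\<And>t. 0 \<le> t \<Longrightarrow> a \<le> v x t" for a x
    unfolding q_def using that by (intro cINF_greatest) auto
  show "q x \<le> p x" for x
    using q_le[of 0 x] by (simp add: v_def)
  show "q (- y) \<le> - p y"
    using q_le[of 1 "- y"] by (simp add: v_def sublinearD(3)[OF p])
  show "sublinear q"
  proof (rule sublinearI)
    fix x z
    have "q (x + z) - v x s \<le> v z t" if "0 \<le> s" "0 \<le> t" for s t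
    proof -
      have "q (x + z) \<le> v (x + z) (s + t)"
        using that by (intro q_le) auto
      also have "\<dots> \<le> v x s + v z t"
        using sublinearD(1)[OF p, of "x + s *\<^sub>R y" "z + t *\<^sub>R y"]
        by (simp add: v_def algebra_simps)
      finally show ?thesis by simp
    qed
    then have "q (x + z) - v x s \<le> q z" if "0 \<le> s" for s
      using that by (intro q_greatest)
    then have "q (x + z) - q z \<le> q x"
      by (intro q_greatest) (simp add: algebra_simps)
    then show "q (x + z) \<le> q x + q z" by simp
  next
    have "q 0 \<le> 0" using q_le[of 0 0] by (simp add: v_def sublinearD(3)[OF p])
    moreover have "0 \<le> q 0"
      using lower[of _ 0] by (intro q_greatest) (simp add: sublinearD(3)[OF p])
    ultimately show "q 0 = 0" by simp
  next
    fix c :: real and x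
    assume c: "0 < c"
    have "q (c *\<^sub>R x) / c \<le> v x t" if "0 \<le> t" for t
    proof -
      have "q (c *\<^sub>R x) \<le> v (c *\<^sub>R x) (c * t)"
        using that c by (intro q_le) auto
      also have "\<dots> = c * v x t"
        using sublinearD(2)[OF p, of c "x + t *\<^sub>R y"] c
        by (simp add: v_def algebra_simps)
      finally show ?thesis using c by (simp add: field_simps)
    qed
    then have "q (c *\<^sub>R x) / c \<le> q x" by (rule q_greatest)
    then show "q (c *\<^sub>R x) \<le> c * q x" using c by (simp add: field_simps)
  qed
qed

text \<open>Zorn's lemma for the reversed pointwise order. The pointwise infimum of a nonempty chain
  is finite, since every member is at least \<open>- p (- x)\<close> at \<open>x\<close>, and it is
  again sublinear.\<close>

lemma minimal_sublinear_exists: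
  fixes p :: "'a::real_vector \<Rightarrow> real"
  assumes p: "sublinear p"
  obtains f where "sublinear f" "f \<le> p" "\<And>q. sublinear q \<Longrightarrow> q \<le> f \<Longrightarrow> q = f"
proof -
  define A where "A = {q. sublinear q \<and> q \<le> p}"
  have "\<exists>m\<in>A. \<forall>a\<in>A. a \<le> m \<longrightarrow> a = m"
  proof (rule predicate_Zorn)
    show "partial_order_on A (relation_of (\<lambda>x y. y \<le> x) A)"
      by (intro partial_order_on_relation_ofI) auto
  next
    fix C
    assume C: "C \<in> Chains (relation_of (\<lambda>x y. y \<le> x) A)"
    then have CA: "sublinear q" "q \<le> p" if "q \<in> C" for q
      using that by (auto simp: Chains_def relation_of_def A_def)
    have chain: "q \<le> r \<or> r \<le> q" if "q \<in> C" "r \<in> C" for q r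
      using C that by (auto simp: Chains_def relation_of_def)
    show "\<exists>u\<in>A. \<forall>a\<in>C. u \<le> a"
    proof (cases "C = {}")
      case True
      then show ?thesis using p by (auto simp: A_def)
    next
      case False
      define u where "u x = (INF q\<in>C. q x)" for x
      have lower: "- p (- x) \<le> q x" if "q \<in> C" for q x
        using sublinearD(4)[OF CA(1)[OF that], of x] CA(2)[OF that]
        by (smt (verit) le_fun_def)
      have u_le: "u x \<le> q x" if "q \<in> C" for q x
        unfolding u_def using that lower by (intro cINF_lower bdd_belowI2[of _ "- p (- x)"]) auto
      have u_greatest: "a \<le> u x" if "\<And>q. q \<in> C \<Longrightarrow> a \<le> q x" for a x
        unfolding u_def using that False by (intro cINF_greatest) auto
      have "sublinear u"
      proof (rule sublinearI)
        fix x y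
        have "u (x + y) - q x \<le> r y" if "q \<in> C" "r \<in> C" for q r
        proof -
          \<comment> \<open>Here the chain condition enters: one member lies below both
            \<open>q\<close> and \<open>r\<close>. Infima of arbitrary families of sublinear
            functions need not be subadditive.\<close>
          obtain s where s: "s \<in> C" "s \<le> q" "s \<le> r"
            using chain[of q r] \<open>q \<in> C\<close> \<open>r \<in> C\<close> by auto
          have "u (x + y) \<le> s x + s y"
            using u_le[OF s(1), of "x + y"] sublinearD(1)[OF CA(1)[OF s(1)], of x y] by linarith
          also have "\<dots> \<le> q x + r y"
            using s by (intro add_mono) (auto simp: le_fun_def)
          finally show ?thesis by simp
        qed
        then have "u (x + y) - q x \<le> u y" if "q \<in> C" for q
          using that by (intro u_greatest)
        then have "u (x + y) - u y \<le> u x"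
          by (intro u_greatest) (simp add: algebra_simps)
        then show "u (x + y) \<le> u x + u y" by simp
      next
        show "u 0 = 0"
          unfolding u_def using False CA(1) by (simp add: sublinearD(3))
      next
        fix c :: real and x
        assume c: "0 < c"
        have "u (c *\<^sub>R x) / c \<le> q x" if "q \<in> C" for q
          using u_le[OF that, of "c *\<^sub>R x"] sublinearD(2)[OF CA(1)[OF that], of c x] c
          by (simp add: field_simps)
        then have "u (c *\<^sub>R x) / c \<le> u x" by (rule u_greatest)
        then show "u (c *\<^sub>R x) \<le> c * u x" using c by (simp add: field_simps)
      qed
      moreover have "u \<le> p"
        using False u_le CA(2) by (meson ex_in_conv le_fun_def order_trans)
      ultimately show ?thesis
        using u_le by (auto simp: A_def le_fun_def)
    qed
  qed
  then show ?thesis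
    using that by (force simp: A_def)
qed

text \<open>By minimality the tilt of \<open>f\<close> along \<open>y\<close> is \<open>f\<close>
  itself, whence \<open>f (- y) \<le> - f y\<close>. Once \<open>f\<close> is odd, subadditivity and
  positive homogeneity become equalities for all arguments.\<close>

lemma minimal_sublinear_linear:
  fixes f :: "'a::real_vector \<Rightarrow> real"
  assumes f: "sublinear f" and minimal: "\<And>q. sublinear q \<Longrightarrow> q \<le> f \<Longrightarrow> q = f"
  shows "linear f"
proof -
  have minus: "f (- y) = - f y" for y
  proof -
    obtain q where q: "sublinear q" "\<And>x. q x \<le> f x" "q (- y) \<le> - f y"
      using sublinear_tilt[OF f, of y] by blast
    have "q = f" using q by (intro minimal) (auto simp: le_fun_def)
    with q(3) sublinearD(4)[OF f, of "y"] show ?thesis by simp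
  qed
  have "f (x + y) = f x + f y" for x y
    using sublinearD(1)[OF f, of x y] sublinearD(1)[OF f, of "x + y" "- y"] minus[of y] by simp
  moreover have "f (c *\<^sub>R x) = c * f x" for c x
  proof (cases "0 \<le> c")
    case False
    then show ?thesis
      using sublinearD(2)[OF f, of "- c" x] minus[of "c *\<^sub>R x"] by simp
  qed (simp add: sublinearD(2)[OF f])
  ultimately show ?thesis by (intro linearI) auto
qed

text \<open>Tilting along \<open>z\<close> comes before minimizing: every linear \<open>f\<close>
  below the tilted function has \<open>f (- z) \<le> - p z\<close>, and with
  \<open>f z \<le> p z\<close> this fixes the value at \<open>z\<close>.\<close>

theorem Hahn_Banach_sublinear:
  fixes p :: "'a::real_vector \<Rightarrow> real"
  assumes p: "sublinear p"
  obtains f where "linear f" "\<And>x. f x \<le> p x" "f z = p z"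
proof -
  obtain q where q: "sublinear q" "\<And>x. q x \<le> p x" "q (- z) \<le> - p z"
    using sublinear_tilt[OF p, of z] by blast
  obtain f where f: "sublinear f" "f \<le> q" "\<And>r. sublinear r \<Longrightarrow> r \<le> f \<Longrightarrow> r = f"
    using minimal_sublinear_exists[OF q(1)] by blast
  have lin: "linear f" using minimal_sublinear_linear[OF f(1,3)] .
  have le: "f x \<le> p x" for x
    using f(2) q(2) by (meson le_fun_def order_trans)
  have "f z = p z"
    using le[of z] f(2) q(3) linear_neg[OF lin, of z] by (smt (verit) le_fun_def)
  with lin le show ?thesis by (rule that)
qed

section \<open>The distance to a subspace as a dominating function\<close>

lemma sublinear_infdist:
  fixes M :: "'a::real_normed_vector set"
  assumes M: "subspace M"
  shows "sublinear (\<lambda>x. infdist x M)"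
proof -
  have ne: "M \<noteq> {}" using subspace_0[OF M] by auto
  have greatest: "a \<le> infdist x M" if "\<And>m. m \<in> M \<Longrightarrow> a \<le> dist x m" for a x
    using that ne unfolding infdist_notempty[OF ne] by (intro cINF_greatest)
  show ?thesis
  proof (rule sublinearI)
    fix x y
    have "infdist (x + y) M - dist x m \<le> dist y n" if "m \<in> M" "n \<in> M" for m n
    proof -
      have "infdist (x + y) M \<le> dist (x + y) (m + n)"
        using that M by (intro infdist_le subspace_add)
      also have "\<dots> \<le> dist x m + dist y n" by (rule dist_triangle_add)
      finally show ?thesis by simp
    qed
    then have "infdist (x + y) M - dist x m \<le> infdist y M" if "m \<in> M" for m
      using that by (intro greatest)
    then have "infdist (x + y) M - infdist y M \<le> infdist x M"
      by (intro greatest) (simp add: algebra_simps)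
    then show "infdist (x + y) M \<le> infdist x M + infdist y M" by simp
  next
    show "infdist 0 M = 0" using subspace_0[OF M] by simp
  next
    fix c :: real and x
    assume c: "0 < c"
    have "infdist (c *\<^sub>R x) M / c \<le> dist x m" if "m \<in> M" for m
    proof -
      have "infdist (c *\<^sub>R x) M \<le> dist (c *\<^sub>R x) (c *\<^sub>R m)"
        using that M by (intro infdist_le subspace_scale)
      also have "\<dots> = c * dist x m" using c by (simp add: dist_norm flip: scaleR_diff_right)
      finally show ?thesis using c by (simp add: field_simps)
    qed
    then have "infdist (c *\<^sub>R x) M / c \<le> infdist x M" by (rule greatest)
    then show "infdist (c *\<^sub>R x) M \<le> c * infdist x M" using c by (simp add: field_simps)
  qed
qed

text \<open>The distance to \<open>M\<close> is the quotient seminorm, and it is even because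
  \<open>M\<close> is closed under negation. The single bound by it says both that \<open>f\<close>
  vanishes on \<open>M\<close> and that \<open>f\<close> has norm at most one.\<close>

lemma Hahn_Banach_real:
  fixes M :: "'a::real_normed_vector set"
  assumes M: "subspace M"
  obtains f where "linear f" "\<And>x. \<bar>f x\<bar> \<le> infdist x M" "f z = infdist z M"
proof -
  obtain f where f: "linear f" "\<And>x. f x \<le> infdist x M" "f z = infdist z M"
    using Hahn_Banach_sublinear[OF sublinear_infdist[OF M]] by blast
  have "infdist (- x) M \<le> infdist x M" for x
  proof -
    have ne: "M \<noteq> {}" using subspace_0[OF M] by auto
    show ?thesis
      unfolding infdist_notempty[OF ne, of x]
    proof (rule cINF_greatest[OF ne])
      fix m assume "m \<in> M"
      then have "infdist (- x) M \<le> dist (- x) (- m)"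
        using M by (intro infdist_le subspace_neg)
      then show "infdist (- x) M \<le> dist x m" by (simp add: dist_minus)
    qed
  qed
  then have "\<bar>f x\<bar> \<le> infdist x M" for x
    using f(2)[of x] f(2)[of "- x"] linear_neg[OF f(1), of x] by (smt (verit))
  with f(1,3) that show ?thesis by blast
qed

section \<open>Biorthogonal systems and dimension\<close>

lemma linear_functionalD:
  assumes "Vector_Spaces.linear scl ((*) :: 'k::field \<Rightarrow> 'k \<Rightarrow> 'k) f"
  shows "f (x + y) = f x + f y" "f (x - y) = f x - f y" "f 0 = 0" "f (scl c x) = c * f x"
    "f (\<Sum>i\<in>I. h i) = (\<Sum>i\<in>I. f (h i))"
proof -
  interpret f: Vector_Spaces.linear scl "(*)" f by fact
  show "f (x + y) = f x + f y" "f (x - y) = f x - f y" "f 0 = 0" "f (scl c x) = c * f x"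
    "f (\<Sum>i\<in>I. h i) = (\<Sum>i\<in>I. f (h i))"
    by (rule f.add f.diff f.zero f.scale f.sum)+
qed

text \<open>The functionals index themselves, and the dual vector is sought for each
  \<open>i\<close> separately instead of as one family, so that each condition concerns a single
  vector.\<close>

definition (in vector_space) biorthogonal_in :: "'b set \<Rightarrow> ('b \<Rightarrow> 'a) set \<Rightarrow> bool" where
  "biorthogonal_in K J \<longleftrightarrow> (\<forall>i\<in>J. \<exists>x\<in>K. \<forall>j\<in>J. j x = (if j = i then 1 else 0))"

text \<open>Applying \<open>j\<close> to a vanishing linear combination of the dual vectors isolates
  the coefficient of \<open>e j\<close>.\<close>

lemma (in vector_space) independent_of_biorthogonal:
  assumes lin: "\<And>j. j \<in> J \<Longrightarrow> Vector_Spaces.linear scale (*) j"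
    and J: "finite J" "biorthogonal_in K J"
  obtains B where "B \<subseteq> K" "independent B" "finite B" "card B = card J"
proof -
  from J(2) obtain e where e: "\<And>i. i \<in> J \<Longrightarrow> e i \<in> K"
    "\<And>i j. i \<in> J \<Longrightarrow> j \<in> J \<Longrightarrow> j (e i) = (if j = i then 1 else 0)"
    unfolding biorthogonal_in_def by metis
  have inj: "inj_on e J"
    using e(2) by (metis inj_onI zero_neq_one)
  have "independent (e ` J)"
  proof (rule independent_if_scalars_zero)
    fix u x
    assume 0: "(\<Sum>x\<in>e ` J. scale (u x) x) = 0" and "x \<in> e ` J"
    then obtain j where j: "j \<in> J" "x = e j" by auto
    have "(\<Sum>i\<in>J. scale (u (e i)) (e i)) = 0"
      using 0 by (simp add: sum.reindex[OF inj])
    then have "0 = j (\<Sum>i\<in>J. scale (u (e i)) (e i))"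
      by (simp add: linear_functionalD(3)[OF lin[OF j(1)]])
    also have "\<dots> = (\<Sum>i\<in>J. u (e i) * j (e i))"
      by (simp add: linear_functionalD(4,5)[OF lin[OF j(1)]])
    also have "\<dots> = (\<Sum>i\<in>J. if i = j then u (e i) else 0)"
      by (intro sum.cong) (auto simp: e(2) j(1))
    also have "\<dots> = u x"
      using J(1) j by simp
    finally show "u x = 0" by simp
  qed (use J in simp)
  then show ?thesis
    using that[of "e ` J"] e(1) J(1) inj by (auto simp: card_image)
qed

text \<open>Induction in the manner of Gram-Schmidt: a vector of \<open>K\<close> outside the span
  of the dual vectors found so far is moved into the common kernel of \<open>J\<close>, and a
  functional of \<open>F\<close> that does not vanish there is adjoined.\<close>

lemma (in vector_space) biorthogonal_of_independent:
  assumes K: "subspace K"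
    and lin: "\<And>f. f \<in> F \<Longrightarrow> Vector_Spaces.linear scale (*) f"
    and sep: "\<And>x. x \<in> K \<Longrightarrow> x \<noteq> 0 \<Longrightarrow> \<exists>f\<in>F. f x \<noteq> 0"
    and B: "B \<subseteq> K" "independent B" "finite B"
  shows "\<exists>J\<subseteq>F. finite J \<and> card J = card B \<and> biorthogonal_in K J"
  using B(3,1,2)
proof (induction B rule: finite_induct)
  case empty
  then show ?case by (intro exI[of _ "{}"]) (auto simp: biorthogonal_in_def)
next
  case (insert b B)
  then obtain J where J: "J \<subseteq> F" "finite J" "card J = card B" "biorthogonal_in K J"
    using independent_mono[of "insert b B" B] by auto
  from J(4) obtain e where e: "\<And>i. i \<in> J \<Longrightarrow> e i \<in> K"
    "\<And>i j. i \<in> J \<Longrightarrow> j \<in> J \<Longrightarrow> j (e i) = (if j = i then 1 else 0)"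
    unfolding biorthogonal_in_def by metis
  \<comment> \<open>The dual vectors number at most \<open>card B\<close>, too few to span an
    independent set with one element more.\<close>
  have "\<not> insert b B \<subseteq> span (e ` J)"
  proof
    assume "insert b B \<subseteq> span (e ` J)"
    then have "card (insert b B) \<le> card (e ` J)"
      using independent_span_bound[of "e ` J" "insert b B"] insert.prems J(2) by auto
    also have "\<dots> \<le> card B" using card_image_le[OF J(2), of e] J(3) by simp
    finally show False using insert.hyps by simp
  qed
  then obtain x where x: "x \<in> K" "x \<notin> span (e ` J)"
    using insert.prems by auto
  \<comment> \<open>Subtracting the components \<open>i x\<close> along the dual vectors leaves a
    vector that all of \<open>J\<close> annihilates.\<close>
  define y where "y = x - (\<Sum>i\<in>J. scale (i x) (e i))"
  have yK: "y \<in> K"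
    unfolding y_def using x(1) e(1) by (intro subspace_diff subspace_sum subspace_scale K)
  have "y \<noteq> 0"
  proof
    assume "y = 0"
    then have "x = (\<Sum>i\<in>J. scale (i x) (e i))" by (simp add: y_def)
    also have "\<dots> \<in> span (e ` J)" by (intro span_sum span_scale span_base) auto
    finally show False using x(2) by simp
  qed
  have jy: "j y = 0" if "j \<in> J" for j
  proof -
    have j: "Vector_Spaces.linear scale (*) j" using that J(1) lin by auto
    have "j (\<Sum>i\<in>J. scale (i x) (e i)) = (\<Sum>i\<in>J. i x * j (e i))"
      by (simp add: linear_functionalD(4,5)[OF j])
    also have "\<dots> = (\<Sum>i\<in>J. if i = j then i x else 0)"
      by (intro sum.cong) (auto simp: e(2) that)
    also have "\<dots> = j x" using J(2) that by simp
    finally show ?thesis by (simp add: y_def linear_functionalD(2)[OF j])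
  qed
  obtain g where g: "g \<in> F" "g y \<noteq> 0"
    using sep[OF yK \<open>y \<noteq> 0\<close>] by auto
  then have "g \<notin> J" using jy by auto
  define z where "z = scale (inverse (g y)) y"
  have z: "z \<in> K" "g z = 1" "\<And>j. j \<in> J \<Longrightarrow> j z = 0"
  proof -
    show "z \<in> K" unfolding z_def by (intro subspace_scale K yK)
    show "g z = 1" using g by (simp add: z_def linear_functionalD(4)[OF lin[OF g(1)]])
    show "j z = 0" if "j \<in> J" for j
    proof -
      have j: "Vector_Spaces.linear scale (*) j" using that J(1) lin by auto
      show ?thesis by (simp add: z_def linear_functionalD(4)[OF j] jy[OF that])
    qed
  qed
  have "biorthogonal_in K (insert g J)"
    unfolding biorthogonal_in_def
  proof
    fix i assume i: "i \<in> insert g J"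
    show "\<exists>x\<in>K. \<forall>j\<in>insert g J. j x = (if j = i then 1 else 0)"
    proof (cases "i = g")
      case True
      then show ?thesis using z \<open>g \<notin> J\<close> by (intro bexI[of _ z]) auto
    next
      case False
      then have iJ: "i \<in> J" using i by simp
      \<comment> \<open>An old dual vector is corrected by a multiple of \<open>z\<close> so that
        \<open>g\<close> kills it too; its values under \<open>J\<close> do not change because
        \<open>J\<close> kills \<open>z\<close>.\<close>
      let ?w = "e i - scale (g (e i)) z"
      have "?w \<in> K" using iJ e(1) z(1) by (intro subspace_diff subspace_scale K)
      moreover have "j ?w = (if j = i then 1 else 0)" if "j \<in> insert g J" for j
      proof -
        have j: "Vector_Spaces.linear scale (*) j" using that J(1) g(1) lin by auto
        have "j ?w = j (e i) - g (e i) * j z"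
          by (simp add: linear_functionalD(2)[OF j] linear_functionalD(4)[OF j])
        then show ?thesis using that z(2) z(3)[of j] e(2)[OF iJ, of j] False by auto
      qed
      ultimately show ?thesis by blast
    qed
  qed
  then show ?case
    using J g \<open>g \<notin> J\<close> insert.hyps by (intro exI[of _ "insert g J"]) auto
qed

section \<open>Dimension measured by finite independent sets\<close>

text \<open>This expresses that the dimension is at least \<open>n\<close>. Unlike
  \<open>dim\<close>, it does not collapse to 0 in infinite dimension.\<close>

definition (in vector_space) has_independent :: "nat \<Rightarrow> 'b set \<Rightarrow> bool" where
  "has_independent n K \<longleftrightarrow> (\<exists>B\<subseteq>K. independent B \<and> finite B \<and> card B = n)"

lemma (in vector_space) dim_eq_iff_has_independent:
  assumes "1 \<le> n"
  shows "dim K = n \<longleftrightarrow> has_independent n K \<and> \<not> has_independent (Suc n) K"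
proof
  assume n: "dim K = n"
  obtain B where B: "B \<subseteq> K" "independent B" "K \<subseteq> span B" "card B = n"
    using basis_exists[of K] n by metis
  \<comment> \<open>An infinite basis would have \<open>card B = 0\<close>, against
    \<open>1 \<le> n\<close>.\<close>
  with assms have fin: "finite B" using card.infinite by fastforce
  have "\<not> has_independent (Suc n) K"
  proof
    assume "has_independent (Suc n) K"
    then obtain A where A: "A \<subseteq> K" "independent A" "card A = Suc n"
      by (auto simp: has_independent_def)
    then have "card A \<le> card B" using independent_span_bound[OF fin] B(3) by blast
    with A B show False by simp
  qed
  with B fin show "has_independent n K \<and> \<not> has_independent (Suc n) K"
    by (auto simp: has_independent_def)
next
  assume n: "has_independent n K \<and> \<not> has_independent (Suc n) K"
  obtain B where B: "B \<subseteq> K" "independent B" "K \<subseteq> span B" "card B = dim K"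
    using basis_exists by blast
  have no: False if A: "A \<subseteq> B" "finite A" "card A = Suc n" for A
  proof -
    have "A \<subseteq> K" "independent A" using A(1) B(1) independent_mono[OF B(2) A(1)] by auto
    with A n show False by (auto simp: has_independent_def)
  qed
  have fin: "finite B"
    using infinite_arbitrarily_large[of B "Suc n"] no by blast
  have "card B \<le> n"
  proof (rule ccontr)
    assume "\<not> card B \<le> n"
    then have "Suc n \<le> card B" by simp
    then obtain A where "A \<subseteq> B" "card A = Suc n" "finite A"
      by (rule obtain_subset_with_card_n)
    then show False using no by blast
  qed
  moreover from n obtain A where A: "A \<subseteq> K" "independent A" "card A = n"
    by (auto simp: has_independent_def)
  then have "n \<le> card B" using independent_span_bound[OF fin] B(3) by blast
  ultimately show "dim K = n" using B(4) by simp
qed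

text \<open>A subspace has \<open>dim K = 0\<close> only if it is zero or infinite-dimensional, so
  the left side leaves exactly the infinite-dimensional case.\<close>

lemma (in vector_space) infinite_dim_iff_has_independent:
  assumes "subspace K"
  shows "K \<noteq> {0} \<and> (\<forall>n\<ge>1. dim K \<noteq> n) \<longleftrightarrow> (\<forall>n. has_independent n K)"
proof
  assume *: "K \<noteq> {0} \<and> (\<forall>n\<ge>1. dim K \<noteq> n)"
  obtain B where B: "B \<subseteq> K" "independent B" "K \<subseteq> span B" "card B = dim K"
    using basis_exists by blast
  have "card B = 0" using * B(4) by (metis One_nat_def Suc_leI neq0_conv)
  moreover have "B \<noteq> {}" using * B(3) subspace_0[OF assms] by auto
  ultimately have inf: "infinite B" by auto
  show "\<forall>n. has_independent n K"
  proof
    fix n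
    obtain A where A: "A \<subseteq> B" "finite A" "card A = n"
      using infinite_arbitrarily_large[OF inf] by blast
    have "A \<subseteq> K" "independent A" using A(1) B(1) independent_mono[OF B(2) A(1)] by auto
    with A show "has_independent n K" by (auto simp: has_independent_def)
  qed
next
  assume *: "\<forall>n. has_independent n K"
  then obtain A where A: "A \<subseteq> K" "independent A" "card A = 1"
    by (auto simp: has_independent_def)
  then have "K \<noteq> {0}" by (metis card_1_singletonE dependent_single insert_subset singletonD)
  then show "K \<noteq> {0} \<and> (\<forall>n\<ge>1. dim K \<noteq> n)"
    using * dim_eq_iff_has_independent by blast
qed

section \<open>Continuous functionals and the weak topology\<close>

definition continuous_functional ::
    "('k::real_normed_field \<Rightarrow> 'a::real_normed_vector \<Rightarrow> 'a) \<Rightarrow> ('a \<Rightarrow> 'k) \<Rightarrow> bool" where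
  "continuous_functional scl f \<longleftrightarrow> Vector_Spaces.linear scl (*) f \<and> continuous_on UNIV f"

text \<open>The Hahn-Banach theorem is made an assumption so that one argument serves both scalar
  fields; the real and the complex case are established separately. As \<open>0 \<in> M\<close>, the
  bound by \<open>infdist x M\<close> includes continuity.\<close>

locale hahn_banach_space = vector_space scl
  for scl :: "'k::real_normed_field \<Rightarrow> 'a::real_normed_vector \<Rightarrow> 'a" +
  assumes hahn_banach: "subspace M \<Longrightarrow>
    \<exists>f. Vector_Spaces.linear scl (*) f \<and> (\<forall>x. norm (f x) \<le> infdist x M) \<and> norm (f z) = infdist z M"
begin

lemma separating_functional:
  assumes M: "subspace M"
  obtains f where "continuous_functional scl f" "\<And>x. norm (f x) \<le> norm x"
    "\<And>x. x \<in> M \<Longrightarrow> f x = 0" "norm (f z) = infdist z M"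
proof -
  obtain f where f: "Vector_Spaces.linear scl (*) f" "\<And>x. norm (f x) \<le> infdist x M"
      "norm (f z) = infdist z M"
    using hahn_banach[OF M] by blast
  have le: "norm (f x) \<le> norm x" for x
    using f(2)[of x] infdist_le[OF subspace_0[OF M], of x] by simp
  have "1-lipschitz_on UNIV f"
    by (rule lipschitz_onI) (simp_all add: dist_norm le flip: linear_functionalD(2)[OF f(1)])
  then have "continuous_on UNIV f" by (rule lipschitz_on_continuous_on)
  moreover have "f x = 0" if "x \<in> M" for x
    using f(2)[of x] infdist_zero[OF that] by simp
  ultimately show ?thesis
    using le f(1,3) by (intro that[of f]) (simp_all add: continuous_functional_def)
qed

lemma norming_functional:
  obtains f where "continuous_functional scl f" "\<And>x. norm (f x) \<le> norm x" "norm (f z) = norm z"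
proof -
  have "infdist z {0} = norm z" by (simp add: infdist_notempty)
  then show ?thesis using separating_functional[OF subspace_single_0, of z] that by metis
qed

text \<open>Norming functionals of a dense subset of \<open>D\<close> suffice:
  \<open>\<phi> q\<close> has norm at most one and attains \<open>norm q\<close> at
  \<open>q\<close>, so it cannot vanish at a point \<open>x\<close> whose distance from
  \<open>q\<close> is less than \<open>norm x / 2\<close>.\<close>

lemma countable_separating_functionals:
  assumes D: "subspace D" "separable_space (top_of_set D)"
  obtains F where "countable F" "\<And>f. f \<in> F \<Longrightarrow> continuous_functional scl f"
    "\<And>x. x \<in> D \<Longrightarrow> x \<noteq> 0 \<Longrightarrow> \<exists>f\<in>F. f x \<noteq> 0"
proof -
  obtain Q where Q: "countable Q" "Q \<subseteq> D" "D \<subseteq> closure Q"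
    using D(2) by (auto simp: separable_space_def closure_of_subtopology Int_absorb1)
  obtain \<phi> where \<phi>: "\<And>z. continuous_functional scl (\<phi> z)" "\<And>z x. norm (\<phi> z x) \<le> norm x"
      "\<And>z. norm (\<phi> z z) = norm z"
  proof -
    have "\<exists>f. continuous_functional scl f \<and> (\<forall>x. norm (f x) \<le> norm x) \<and> norm (f z) = norm z" for z
      using norming_functional[of z] by blast
    then show ?thesis using that by metis
  qed
  show ?thesis
  proof
    show "countable (\<phi> ` Q)" using Q(1) by simp
    show "continuous_functional scl f" if "f \<in> \<phi> ` Q" for f using that \<phi>(1) by auto
    fix x assume x: "x \<in> D" "x \<noteq> 0"
    then obtain q where q: "q \<in> Q" "dist q x < norm x / 2"
      using Q(3) by (metis closure_approachable half_gt_zero subsetD zero_less_norm_iff)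
    have "\<phi> q x \<noteq> 0"
    proof
      assume 0: "\<phi> q x = 0"
      have lin: "Vector_Spaces.linear scl (*) (\<phi> q)"
        using \<phi>(1)[of q] by (simp add: continuous_functional_def)
      have "norm q = norm (\<phi> q (q - x))"
        using 0 \<phi>(3)[of q] by (simp add: linear_functionalD(2)[OF lin])
      also have "\<dots> \<le> dist q x" using \<phi>(2) by (simp add: dist_norm)
      finally have "norm q < norm x / 2" using q(2) by simp
      moreover have "norm x \<le> norm q + dist q x"
        by (metis dist_norm norm_minus_commute norm_triangle_sub)
      ultimately show False using q(2) by simp
    qed
    then show "\<exists>f\<in>\<phi> ` Q. f x \<noteq> 0" using q(1) by blast
  qed
qed

end

section \<open>Graphs and kernels as subspaces\<close>

definition pair_scale :: "('k \<Rightarrow> 'a \<Rightarrow> 'a) \<Rightarrow> 'k \<Rightarrow> 'a \<times> 'a \<Rightarrow> 'a \<times> 'a" where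
  "pair_scale scl c z = (scl c (fst z), scl c (snd z))"

lemma vector_space_pair_scale:
  assumes "vector_space scl"
  shows "vector_space (pair_scale scl)"
proof -
  interpret vector_space scl by fact
  show ?thesis
    by unfold_locales
      (auto simp: pair_scale_def scale_right_distrib scale_left_distrib)
qed

lemma operator_graph_iff: "(x, y) \<in> operator_graph D T \<longleftrightarrow> x \<in> D \<and> y = T x"
  by (auto simp: operator_graph_def)

lemma subspace_operator_graph:
  assumes "vector_space scl" "operator_in scl D T"
  shows "module.subspace (pair_scale scl) (operator_graph D T)"
proof -
  interpret vector_space scl by fact
  interpret P: vector_space "pair_scale scl"
    by (intro vector_space_pair_scale vector_space_axioms)
  have D: "subspace D" and T: "\<And>x y. x \<in> D \<Longrightarrow> y \<in> D \<Longrightarrow> T (x + y) = T x + T y"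
    "\<And>c x. x \<in> D \<Longrightarrow> T (scl c x) = scl c (T x)"
    using assms(2) by (auto simp: operator_in_def)
  have "T 0 = 0"
    using T(2)[OF subspace_0[OF D], of 0] by simp
  then show ?thesis
    unfolding P.subspace_def using D T
    by (auto simp: operator_graph_def pair_scale_def zero_prod_def
        subspace_0 subspace_add subspace_scale)
qed

lemma subspace_operator_kernel:
  assumes "vector_space scl" "operator_in scl D T"
  shows "module.subspace scl (operator_kernel scl D T l)"
proof -
  interpret vector_space scl by fact
  have D: "subspace D" and T: "\<And>x y. x \<in> D \<Longrightarrow> y \<in> D \<Longrightarrow> T (x + y) = T x + T y"
    "\<And>c x. x \<in> D \<Longrightarrow> T (scl c x) = scl c (T x)"
    using assms(2) by (auto simp: operator_in_def)
  have "T 0 = 0"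
    using T(2)[OF subspace_0[OF D], of 0] by simp
  then show ?thesis
    unfolding subspace_def operator_kernel_def using D T
    by (auto simp: subspace_0 subspace_add subspace_scale scale_right_distrib mult.commute)
qed

section \<open>Weak continuity, projections along compact sets, functionals on the product\<close>

lemma continuous_map_weak_topology:
  assumes "continuous_functional scl f"
  shows "continuous_map (weak_topology scl) euclidean f"
proof -
  have *: "openin (weak_topology scl) (f -` U)" if "open U" for U
    unfolding weak_topology_def
    by (rule topology_generated_by_Basis) (use assms that in \<open>auto simp: continuous_functional_def\<close>)
  have "topspace (weak_topology scl) = UNIV"
    using openin_subset[OF *[of UNIV]] by auto
  then show ?thesis using * by (simp add: continuous_map_def vimage_def)
qed

lemma continuous_map_times:
  fixes f g :: "'a \<Rightarrow> 'b::real_normed_algebra"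
  assumes "continuous_map X euclidean f" "continuous_map X euclidean g"
  shows "continuous_map X euclidean (\<lambda>x. f x * g x)"
proof -
  have "continuous_map (prod_topology euclidean euclidean) euclidean (\<lambda>z :: 'b \<times> 'b. fst z * snd z)"
    by (auto intro!: continuous_intros)
  from continuous_map_compose[OF continuous_map_pairedI[OF assms] this]
  show ?thesis by (simp add: o_def)
qed

text \<open>The common solution set is closed in the product of \<open>C\<close> with the parameter
  space, and projection along a compact factor is a closed map. The family \<open>H\<close> may be
  infinite, since one \<open>x\<close> has to satisfy all its equations at once.\<close>

lemma closed_projection_along_compact:
  fixes H :: "('a \<times> 'b::topological_space \<Rightarrow> 'c::t1_space) set"
  assumes C: "compactin X C"
    and H: "\<And>h. h \<in> H \<Longrightarrow> continuous_map (prod_topology X euclidean) euclidean h"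
  shows "closed {l. \<exists>x\<in>C. \<forall>h\<in>H. h (x, l) = c}"
proof -
  let ?Y = "prod_topology (subtopology X C) (euclidean :: 'b topology)"
  have top: "topspace ?Y = C \<times> UNIV"
    using compactin_subset_topspace[OF C] by auto
  let ?S = "\<lambda>h. {z \<in> topspace ?Y. h z \<in> {c}}"
  have cl: "closedin ?Y (topspace ?Y)" by (rule closedin_topspace)
  have "closedin ?Y (?S h)" if "h \<in> H" for h
  proof (rule closedin_continuous_map_preimage)
    show "continuous_map ?Y euclidean h"
      using H[OF that] by (metis continuous_map_from_subtopology prod_topology_subtopology(1))
  qed simp
  \<comment> \<open>Intersecting with the whole space covers empty \<open>H\<close>, for which the
    inner intersection is \<open>UNIV\<close>.\<close>
  then have "closedin ?Y (topspace ?Y \<inter> \<Inter> (?S ` H))"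
    using cl by (cases "H = {}") (simp, intro closedin_Int closedin_Inter, auto)
  moreover have "closed_map ?Y euclidean snd"
    using C by (intro closed_map_snd) (simp add: compact_space_subtopology)
  ultimately have "closed (snd ` (topspace ?Y \<inter> \<Inter> (?S ` H)))"
    by (auto simp: closed_map_def)
  moreover have "snd ` (topspace ?Y \<inter> \<Inter> (?S ` H)) = {l. \<exists>x\<in>C. \<forall>h\<in>H. h (x, l) = c}"
    unfolding top by (force simp: image_iff)
  ultimately show ?thesis by simp
qed

text \<open>The dual of the product is the product of the duals. Closedness of the graph can thus be
  tested with functionals on the single space, where the weak topology is given.\<close>

lemma pair_functional_components:
  fixes h :: "'a::real_normed_vector \<times> 'a \<Rightarrow> 'k::real_normed_field"
  assumes h: "continuous_functional (pair_scale scl) h" and "vector_space scl"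
  shows "continuous_functional scl (\<lambda>x. h (x, 0))" "continuous_functional scl (\<lambda>y. h (0, y))"
    "h (x, y) = h (x, 0) + h (0, y)"
proof -
  interpret vector_space scl by fact
  have lin: "Vector_Spaces.linear (pair_scale scl) (*) h" and cont: "continuous_on UNIV h"
    using h by (auto simp: continuous_functional_def)
  have k: "vector_space ((*) :: 'k \<Rightarrow> _)" using lin by (simp add: Vector_Spaces.linear_iff)
  have "continuous_on UNIV (\<lambda>x. h (x, 0))" "continuous_on UNIV (\<lambda>y. h (0, y))"
    by (rule continuous_on_compose2[OF cont]; auto intro!: continuous_intros)+
  then show "continuous_functional scl (\<lambda>x. h (x, 0))" "continuous_functional scl (\<lambda>y. h (0, y))"
    using linear_functionalD(1)[OF lin, of "(u, 0)" "(v, 0)" for u v]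
      linear_functionalD(1)[OF lin, of "(0, u)" "(0, v)" for u v]
      linear_functionalD(4)[OF lin, of c "(u, 0)" for c u]
      linear_functionalD(4)[OF lin, of c "(0, u)" for c u] k vector_space_axioms
    by (auto simp: continuous_functional_def Vector_Spaces.linear_iff pair_scale_def)
  show "h (x, y) = h (x, 0) + h (0, y)"
    using linear_functionalD(1)[OF lin, of "(x, 0)" "(0, y)"] by simp
qed

section \<open>Closure properties of F-sigma sets\<close>

lemma fsigma_iff_fsigma_in: "fsigma S \<longleftrightarrow> fsigma_in euclidean S"
proof
  assume "fsigma S"
  then obtain F :: "nat \<Rightarrow> 'a set" where F: "\<And>n. closed (F n)" "S = \<Union> (range F)"
    by (auto elim: fsigma.cases)
  show "fsigma_in euclidean S"
    unfolding F(2) using F(1) by (intro fsigma_in_Union) (auto simp: closed_imp_fsigma_in)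
next
  assume "fsigma_in euclidean S"
  then obtain F :: "nat \<Rightarrow> 'a set" where
    F: "(\<forall>n. closedin euclidean (F n)) \<and> (\<forall>n. F n \<subseteq> F (Suc n)) \<and> \<Union> (range F) = S"
    unfolding fsigma_in_ascending by (rule exE)
  have "fsigma (\<Union> (range F))"
    using F by (intro fsigma.intros) simp
  with F show "fsigma S" by simp
qed

lemma fsigma_UN:
  assumes "countable I" "\<And>i. i \<in> I \<Longrightarrow> fsigma (A i)"
  shows "fsigma (\<Union>i\<in>I. A i)"
  using assms unfolding fsigma_iff_fsigma_in by (intro fsigma_in_Union) auto

lemma fsigma_finite_INT:
  assumes "finite I" "\<And>i. i \<in> I \<Longrightarrow> fsigma (A i)"
  shows "fsigma (\<Inter>i\<in>I. A i)"
  using assms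
proof (induction I rule: finite_induct)
  case empty
  then show ?case using fsigma_in_topspace[of euclidean] by (simp add: fsigma_iff_fsigma_in)
next
  case (insert i I)
  then show ?case by (auto simp: fsigma_iff_fsigma_in intro: fsigma_in_Int)
qed

section \<open>Eigenvalues of closable operators\<close>

text \<open>Hahn-Banach is required on the product as well, to separate points from the closure of
  the graph.\<close>

locale closable_operator_space = hahn_banach_space scl
  for scl :: "'k::real_normed_field \<Rightarrow> 'a::real_normed_vector \<Rightarrow> 'a" +
  fixes D T
  assumes pair_hahn_banach: "hahn_banach_space (pair_scale scl)"
    and closable: "closable_operator scl D T"
begin

lemma operator: "operator_in scl D T"
  using closable by (simp add: closable_operator_def)

text \<open>
  The closure of the graph is a closed subspace meeting \<open>D \<times> X\<close> in the graph of
  \<open>T\<close>, so by Hahn-Banach the eigenvalue equation is detected by the pairs of functionals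
  annihilating the graph.
\<close>

definition annihilator :: "(('a \<Rightarrow> 'k) \<times> ('a \<Rightarrow> 'k)) set" where
  "annihilator = {(f, g). continuous_functional scl f \<and> continuous_functional scl g \<and>
     (\<forall>x\<in>D. f x + g (T x) = 0)}"

text \<open>For the converse, if \<open>(x, scl l x)\<close> lay outside the closure of the graph, a
  separating functional on the product would split into a pair in \<open>annihilator\<close> that
  violates the equation at \<open>x\<close>.\<close>

lemma operator_kernel_iff_annihilator:
  assumes x: "x \<in> D"
  shows "x \<in> operator_kernel scl D T l \<longleftrightarrow> (\<forall>(f, g)\<in>annihilator. f x + l * g x = 0)"
proof
  assume "x \<in> operator_kernel scl D T l"
  then have "T x = scl l x" by (simp add: operator_kernel_def)
  moreover have "g (scl l x) = l * g x" if "continuous_functional scl g" for g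
    using that by (simp add: continuous_functional_def linear_functionalD(4)[of scl g])
  ultimately show "\<forall>(f, g)\<in>annihilator. f x + l * g x = 0"
    using x by (force simp: annihilator_def)
next
  assume ann: "\<forall>(f, g)\<in>annihilator. f x + l * g x = 0"
  obtain E S where ES: "operator_in scl E S" "closure (operator_graph D T) = operator_graph E S"
    using closable by (auto simp: closable_operator_def)
  have sub: "operator_graph D T \<subseteq> operator_graph E S"
    using ES(2) closure_subset by metis
  have "(x, scl l x) \<in> operator_graph E S"
  proof (rule ccontr)
    assume z: "(x, scl l x) \<notin> operator_graph E S"
    interpret P: hahn_banach_space "pair_scale scl" by (rule pair_hahn_banach)
    have cl: "closed (operator_graph E S)" using ES(2) by (metis closed_closure)
    obtain h where h: "continuous_functional (pair_scale scl) h"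
      "\<And>w. w \<in> operator_graph E S \<Longrightarrow> h w = 0"
      "norm (h (x, scl l x)) = infdist (x, scl l x) (operator_graph E S)"
      using P.separating_functional[OF subspace_operator_graph[OF vector_space_axioms ES(1)]] by blast
    have "operator_graph E S \<noteq> {}"
      using sub x operator_graph_iff[of x "T x" D T] by auto
    then have "h (x, scl l x) \<noteq> 0"
      using h(3) in_closed_iff_infdist_zero[OF cl, of "(x, scl l x)"] z by auto
    note comp = pair_functional_components[OF h(1) vector_space_axioms]
    have "(\<lambda>x. h (x, 0), \<lambda>y. h (0, y)) \<in> annihilator"
      using comp(1,2) h(2) sub
      by (auto simp: annihilator_def operator_graph_iff subset_iff simp flip: comp(3))
    then have "h (x, 0) + l * h (0, x) = 0" using ann by auto
    moreover have "h (0, scl l x) = l * h (0, x)"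
      using comp(2) linear_functionalD(4)[of scl "\<lambda>y. h (0, y)" l x]
      by (simp add: continuous_functional_def)
    ultimately show False
      using comp(3)[of x "scl l x"] \<open>h (x, scl l x) \<noteq> 0\<close> by simp
  qed
  \<comment> \<open>Closability is decisive here: the closure is itself a graph, so its points over
    \<open>x\<close> with second entries \<open>scl l x\<close> and \<open>T x\<close>
    coincide.\<close>
  moreover have "(x, T x) \<in> operator_graph E S"
    using x by (intro subsetD[OF sub]) (simp add: operator_graph_iff)
  ultimately show "x \<in> operator_kernel scl D T l"
    using x by (simp add: operator_graph_iff operator_kernel_def)
qed

text \<open>On \<open>C\<close> the eigenvalue equation is replaced by the equations
  \<open>f x + l * g x = 0\<close> over \<open>annihilator\<close>. These no longer mention
  \<open>T\<close> and are jointly continuous in \<open>l\<close> and, weakly, in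
  \<open>x\<close>.\<close>

lemma closed_eigenvalues_in_weakly_compact:
  assumes C: "compactin (weak_topology scl) C" "C \<subseteq> D"
    and J: "\<And>j. j \<in> J \<Longrightarrow> continuous_functional scl j"
  shows "closed {l. \<exists>x\<in>C. x \<in> operator_kernel scl D T l \<and> (\<forall>j\<in>J. j x = c j)}"
proof -
  define H where "H = (\<lambda>(f, g) (x, l). f x + l * g x) ` annihilator \<union>
    (\<lambda>j (x, l). j x - c j) ` J"
  have "closed {l. \<exists>x\<in>C. \<forall>h\<in>H. h (x, l) = 0}"
  proof (rule closed_projection_along_compact[OF C(1)])
    fix h assume h: "h \<in> H"
    have fst: "continuous_map (prod_topology (weak_topology scl) euclidean) euclidean (\<lambda>z. f (fst z))"
      if "continuous_functional scl f" for f
      using continuous_map_compose[OF continuous_map_fst continuous_map_weak_topology[OF that]]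
      by (simp add: o_def)
    have snd: "continuous_map (prod_topology (weak_topology scl) euclidean) euclidean snd"
      by (rule continuous_map_snd)
    from h consider
        f g where "(f, g) \<in> annihilator" "h = (\<lambda>z. f (fst z) + snd z * g (fst z))"
      | j where "j \<in> J" "h = (\<lambda>z. j (fst z) - c j)"
      unfolding H_def case_prod_unfold by fastforce
    then show "continuous_map (prod_topology (weak_topology scl) euclidean) euclidean h"
    proof cases
      case 1
      then show ?thesis
        by (auto simp: annihilator_def intro!: continuous_map_add continuous_map_times fst snd)
    next
      case 2
      then show ?thesis
        using continuous_map_diff[OF fst[OF J[OF 2(1)]] continuous_map_const[THEN iffD2]] by simp
    qed
  qed
  moreover have "(\<forall>h\<in>H. h (x, l) = 0) \<longleftrightarrow>
      x \<in> operator_kernel scl D T l \<and> (\<forall>j\<in>J. j x = c j)" if "x \<in> C" for x l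
    using that C(2) by (subst operator_kernel_iff_annihilator) (auto simp: H_def ball_Un)
  ultimately show ?thesis by (simp cong: bex_cong)
qed

lemma fsigma_has_independent:
  assumes D: "separable_space (top_of_set D)" "weakly_sigma_compact scl D"
  shows "fsigma {l. has_independent n (operator_kernel scl D T l)}"
proof -
  obtain \<C> where \<C>: "countable \<C>" "\<And>C. C \<in> \<C> \<Longrightarrow> compactin (weak_topology scl) C" "\<Union>\<C> = D"
    using D(2) by (auto simp: weakly_sigma_compact_def)
  have "subspace D" using operator by (simp add: operator_in_def)
  then obtain F where F: "countable F" "\<And>f. f \<in> F \<Longrightarrow> continuous_functional scl f"
      "\<And>x. x \<in> D \<Longrightarrow> x \<noteq> 0 \<Longrightarrow> \<exists>f\<in>F. f x \<noteq> 0"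
    using countable_separating_functionals D(1) by blast
  have lin: "Vector_Spaces.linear scl (*) f" if "f \<in> F" for f
    using F(2)[OF that] by (simp add: continuous_functional_def)
  let ?\<J> = "{J. finite J \<and> J \<subseteq> F \<and> card J = n}"
  let ?K = "operator_kernel scl D T"
  let ?B = "\<lambda>J i. {l. \<exists>x\<in>?K l. \<forall>j\<in>J. j x = (if j = i then 1 else 0)}"
  have "has_independent n (?K l) \<longleftrightarrow> (\<exists>J\<in>?\<J>. biorthogonal_in (?K l) J)" for l
  proof
    assume "has_independent n (?K l)"
    then obtain B where B: "B \<subseteq> ?K l" "independent B" "finite B" "card B = n"
      by (auto simp: has_independent_def)
    have "\<exists>f\<in>F. f x \<noteq> 0" if "x \<in> ?K l" "x \<noteq> 0" for x
      using that F(3) by (auto simp: operator_kernel_def)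
    then have "\<exists>J\<subseteq>F. finite J \<and> card J = card B \<and> biorthogonal_in (?K l) J"
      by (intro biorthogonal_of_independent[OF subspace_operator_kernel[OF vector_space_axioms operator]] lin B)
    then show "\<exists>J\<in>?\<J>. biorthogonal_in (?K l) J" using B(4) by auto
  next
    assume "\<exists>J\<in>?\<J>. biorthogonal_in (?K l) J"
    then obtain J where J: "finite J" "J \<subseteq> F" "card J = n" "biorthogonal_in (?K l) J" by auto
    then show "has_independent n (?K l)"
      using independent_of_biorthogonal[of J "?K l"] lin
      by (metis has_independent_def subsetD)
  qed
  \<comment> \<open>Since the dual vectors are chosen independently, the quantifier over
    \<open>i\<close> becomes a finite intersection outside the search for \<open>x\<close>, and
    different \<open>i\<close> may use different weakly compact pieces of \<open>D\<close>.\<close>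
  then have eq: "{l. has_independent n (?K l)} = (\<Union>J\<in>?\<J>. \<Inter>i\<in>J. ?B J i)"
    by (auto simp: biorthogonal_in_def)
  have "fsigma (?B J i)" if "J \<in> ?\<J>" for J i
  proof -
    have "?B J i = (\<Union>C\<in>\<C>. {l. \<exists>x\<in>C. x \<in> ?K l \<and> (\<forall>j\<in>J. j x = (if j = i then 1 else 0))})"
      using \<C>(3) by (fastforce simp: operator_kernel_def)
    moreover have "fsigma \<dots>"
    proof (rule fsigma_UN[OF \<C>(1)])
      fix C assume "C \<in> \<C>"
      then have "closed {l. \<exists>x\<in>C. x \<in> ?K l \<and> (\<forall>j\<in>J. j x = (if j = i then 1 else 0))}"
        using \<C> that F(2) by (intro closed_eigenvalues_in_weakly_compact) auto
      then show "fsigma {l. \<exists>x\<in>C. x \<in> ?K l \<and> (\<forall>j\<in>J. j x = (if j = i then 1 else 0))}"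
        by (simp add: fsigma_iff_fsigma_in closed_imp_fsigma_in)
    qed
    ultimately show ?thesis by simp
  qed
  \<comment> \<open>Only finite subsets of the countable set \<open>F\<close> occur, so the union
    remains countable.\<close>
  moreover have "countable ?\<J>"
    using countable_Collect_finite_subset[OF F(1)] by (rule countable_subset[rotated]) auto
  ultimately show ?thesis
    unfolding eq by (intro fsigma_UN fsigma_finite_INT) auto
qed

theorem point_spectrum_descriptive:
  assumes D: "separable_space (top_of_set D)" "weakly_sigma_compact scl D"
  shows "1 \<le> n \<Longrightarrow> \<exists>F G. fsigma F \<and> gdelta G \<and> point_spectrum_dim scl D T n = F \<inter> G"
    and "fsigma_delta (point_spectrum_inf scl D T)"
proof -
  let ?A = "\<lambda>n. {l. has_independent n (operator_kernel scl D T l)}"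
  note A = fsigma_has_independent[OF D]
  show "\<exists>F G. fsigma F \<and> gdelta G \<and> point_spectrum_dim scl D T n = F \<inter> G" if "1 \<le> n"
  proof (intro exI conjI)
    show "fsigma (?A n)" "gdelta (- ?A (Suc n))"
      using A by (simp_all add: gdelta_complement)
    show "point_spectrum_dim scl D T n = ?A n \<inter> - ?A (Suc n)"
      unfolding point_spectrum_dim_def dim_eq_iff_has_independent[OF that] by blast
  qed
  have "l \<in> point_spectrum_inf scl D T \<longleftrightarrow> (\<forall>n. l \<in> ?A n)" for l
  proof -
    let ?K = "operator_kernel scl D T l"
    have "l \<in> point_spectrum_inf scl D T \<longleftrightarrow> ?K \<noteq> {0} \<and> (\<forall>n\<ge>1. dim ?K \<noteq> n)"
      by (auto simp: point_spectrum_inf_def point_spectrum_def point_spectrum_dim_def simp del: One_nat_def)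
    also have "\<dots> \<longleftrightarrow> (\<forall>n. has_independent n ?K)"
      by (intro infinite_dim_iff_has_independent subspace_operator_kernel vector_space_axioms operator)
    finally show ?thesis by simp
  qed
  then have "point_spectrum_inf scl D T = (\<Inter>n. ?A n)" by blast
  then show "fsigma_delta (point_spectrum_inf scl D T)"
    unfolding fsigma_delta_def using A by (intro exI[of _ ?A]) simp
qed

end

section \<open>Real and complex Banach spaces\<close>

lemma vector_space_mult: "vector_space ((*) :: 'k::field \<Rightarrow> 'k \<Rightarrow> 'k)"
  by unfold_locales (auto simp: algebra_simps)

lemma hahn_banach_space_real:
  "hahn_banach_space ((*\<^sub>R) :: real \<Rightarrow> 'a::real_normed_vector \<Rightarrow> 'a)"
proof (intro hahn_banach_space.intro hahn_banach_space_axioms.intro)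
  show vs: "vector_space ((*\<^sub>R) :: real \<Rightarrow> 'a \<Rightarrow> 'a)"
    by unfold_locales
  fix M :: "'a set" and z
  assume "module.subspace (*\<^sub>R) M"
  then obtain f where f: "linear f" "\<And>x. \<bar>f x\<bar> \<le> infdist x M" "f z = infdist z M"
    using Hahn_Banach_real[of M z] by (auto simp: subspace_raw_def)
  from f(1) have "Vector_Spaces.linear (*\<^sub>R) (*) f"
    by (auto simp: Vector_Spaces.linear_iff linear_iff vs vector_space_mult)
  with f show "\<exists>f. Vector_Spaces.linear (*\<^sub>R) (*) f \<and>
      (\<forall>x. norm (f x) \<le> infdist x M) \<and> norm (f z) = infdist z M"
    by (intro exI[of _ f]) (auto simp: infdist_nonneg)
qed

text \<open>The real theorem provides the real part. The bound passes to the modulus by rotating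
  \<open>g x\<close> onto the nonnegative real axis, as multiplication by a unimodular scalar maps
  \<open>M\<close> into itself and preserves distances.\<close>

lemma (in complex_banach_space) hahn_banach_space_complex: "hahn_banach_space scl"
proof (intro hahn_banach_space.intro hahn_banach_space_axioms.intro)
  show "vector_space scl" by (rule vector_space_axioms)
  fix M :: "'a set" and z
  assume M: "subspace M"
  then have "Real_Vector_Spaces.subspace M"
    by (metis real_vector.subspace_def scale_complex_of_real subspace_def)
  then obtain f where f: "linear f" "\<And>x. \<bar>f x\<bar> \<le> infdist x M" "f z = infdist z M"
    using Hahn_Banach_real[of M z] by blast
  \<comment> \<open>This is \<open>f x - \<i> * f (scl \<i> x)\<close>, the only possible
    complex-linear functional with real part \<open>f\<close>.\<close>
  define g where "g x = Complex (f x) (- f (scl \<i> x))" for x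
  have f_scl: "f (scl c x) = Re c * f x + Im c * f (scl \<i> x)" for c x
  proof -
    have "scl c x = scl (complex_of_real (Re c)) x + scl (complex_of_real (Im c)) (scl \<i> x)"
      using scale_left_distrib[of "complex_of_real (Re c)" "complex_of_real (Im c) * \<i>" x]
      by (simp add: mult.commute flip: complex_eq)
    also have "\<dots> = Re c *\<^sub>R x + Im c *\<^sub>R scl \<i> x"
      by (simp only: scale_complex_of_real)
    finally show ?thesis
      by (simp add: linear_add[OF f(1)] linear_scale[OF f(1)])
  qed
  have g_scl: "g (scl c x) = c * g x" for c x
    using f_scl[of c x] f_scl[of "\<i> * c" x] by (simp add: g_def complex_eq_iff)
  have g_add: "g (x + y) = g x + g y" for x y
    by (simp add: g_def complex_eq_iff linear_add[OF f(1)] scale_right_distrib)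
  have "Vector_Spaces.linear scl (*) g"
    unfolding Vector_Spaces.linear_iff
    by (intro conjI allI vector_space_axioms vector_space_mult g_add g_scl)
  moreover have le: "norm (g x) \<le> infdist x M" for x
  proof (cases "g x = 0")
    case False
    define c where "c = cnj (g x) / norm (g x)"
    have "cnj (g x) * g x = complex_of_real (norm (g x)) * complex_of_real (norm (g x))"
      using complex_norm_square[of "g x"] by (simp add: power2_eq_square mult.commute)
    then have c: "norm c = 1" "c * g x = complex_of_real (norm (g x))"
      using False by (simp_all add: c_def norm_divide)
    have "norm (g x) = Re (g (scl c x))" by (simp add: g_scl c(2))
    also have "\<dots> \<le> infdist (scl c x) M" using f(2)[of "scl c x"] by (simp add: g_def)
    also have "\<dots> \<le> infdist x M"
    proof -
      have ne: "M \<noteq> {}" using subspace_0[OF M] by auto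
      have "infdist (scl c x) M \<le> dist x m" if "m \<in> M" for m
      proof -
        have "infdist (scl c x) M \<le> dist (scl c x) (scl c m)"
          using that M by (intro infdist_le subspace_scale)
        also have "\<dots> = dist x m"
          using c(1) by (simp add: dist_norm norm_scale flip: scale_right_diff_distrib)
        finally show ?thesis .
      qed
      then show ?thesis
        unfolding infdist_notempty[OF ne, of x] by (intro cINF_greatest ne)
    qed
    finally show ?thesis .
  qed (simp add: infdist_nonneg)
  \<comment> \<open>The modulus is at least the real part, which is already
    \<open>infdist z M\<close> at \<open>z\<close>.\<close>
  moreover have "norm (g z) = infdist z M"
    using le[of z] abs_Re_le_cmod[of "g z"] f(3) by (simp add: g_def)
  ultimately show "\<exists>f. Vector_Spaces.linear scl (*) f \<and>
      (\<forall>x. norm (f x) \<le> infdist x M) \<and> norm (f z) = infdist z M"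
    by blast
qed

text \<open>This makes the complex Hahn-Banach theorem available for graphs. The product norm is the
  Euclidean combination of the two norms, hence homogeneous for complex scalars.\<close>

lemma (in complex_banach_space) complex_banach_space_pair: "complex_banach_space (pair_scale scl)"
proof (intro complex_banach_space.intro complex_banach_space_axioms.intro)
  show "vector_space (pair_scale scl)"
    by (intro vector_space_pair_scale vector_space_axioms)
  show "pair_scale scl (complex_of_real r) x = r *\<^sub>R x" for r x
    by (simp add: pair_scale_def scale_complex_of_real prod_eq_iff)
  show "norm (pair_scale scl c x) = cmod c * norm x" for c x
    by (simp add: pair_scale_def norm_scale norm_prod_def power_mult_distrib real_sqrt_mult
        flip: distrib_left)
qed

lemma pair_scale_scaleR: "pair_scale (*\<^sub>R) = (*\<^sub>R)"
  by (auto simp: pair_scale_def fun_eq_iff prod_eq_iff)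

theorem theorem4p2:
  fixes D :: "'a::banach set" and T :: "'a \<Rightarrow> 'a"
    and scl :: "complex \<Rightarrow> 'b::banach \<Rightarrow> 'b" and E :: "'b set" and S :: "'b \<Rightarrow> 'b"
  shows
    "(closable_operator (*\<^sub>R) D T \<and>
      separable_space (top_of_set D) \<and>
      weakly_sigma_compact (*\<^sub>R) D
      \<longrightarrow> (\<forall>n\<ge>1. \<exists>F G. fsigma F \<and> gdelta G \<and> point_spectrum_dim (*\<^sub>R) D T n = F \<inter> G) \<and>
          fsigma_delta (point_spectrum_inf (*\<^sub>R) D T))
     \<and>
     (complex_banach_space scl \<and>
      closable_operator scl E S \<and>
      separable_space (top_of_set E) \<and>
      weakly_sigma_compact scl E
      \<longrightarrow> (\<forall>n\<ge>1. \<exists>F G. fsigma F \<and> gdelta G \<and> point_spectrum_dim scl E S n = F \<inter> G) \<and>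
          fsigma_delta (point_spectrum_inf scl E S))"
proof (intro conjI[of "_ \<longrightarrow> _" "_ \<longrightarrow> _"] impI)
  assume *: "closable_operator (*\<^sub>R) D T \<and> separable_space (top_of_set D) \<and>
    weakly_sigma_compact (*\<^sub>R) D"
  then interpret closable_operator_space "(*\<^sub>R)" D T
    by (intro closable_operator_space.intro closable_operator_space_axioms.intro)
      (auto simp: hahn_banach_space_real pair_scale_scaleR)
  show "(\<forall>n\<ge>1. \<exists>F G. fsigma F \<and> gdelta G \<and> point_spectrum_dim (*\<^sub>R) D T n = F \<inter> G) \<and>
      fsigma_delta (point_spectrum_inf (*\<^sub>R) D T)"
    using * point_spectrum_descriptive by blast
next
  assume *: "complex_banach_space scl \<and> closable_operator scl E S \<and>
    separable_space (top_of_set E) \<and> weakly_sigma_compact scl E"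
  then interpret complex_banach_space scl by blast
  interpret closable_operator_space scl E S
    using * complex_banach_space.hahn_banach_space_complex[OF complex_banach_space_pair]
    by (intro closable_operator_space.intro closable_operator_space_axioms.intro)
      (auto simp: hahn_banach_space_complex)
  show "(\<forall>n\<ge>1. \<exists>F G. fsigma F \<and> gdelta G \<and> point_spectrum_dim scl E S n = F \<inter> G) \<and>
      fsigma_delta (point_spectrum_inf scl E S)"
    using * point_spectrum_descriptive by blast
qed

end
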